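(* Let $H=(V,E)$ be a hypergraph with $V=X\cup\{y\}$, $y\notin X$, such that 1. there exists exactly one edge $e_y\in E$ containing $y$; 2. $H$ has a shadow on $X$, say $H'=(X,E')$. Suppose $J(H')$ fails the persistence property, and let $\mathfrak p'$ be a prime ideal and $s>0$ an integer with $\mathfrak p'\in\operatorname{ass}(J(H')^s)$ and $\mathfrak p'\notin\operatorname{ass}(J(H')^{s+1})$. Let $\tilde H=H_X$ be the induced subhypergraph of $H$ on $X$. If 3. $\mathfrak p'\notin\operatorname{ass}(J(\tilde H)^s)$, and 4. $\mathfrak p'+(y)\notin\operatorname{ass}(J(H)^{s+1}:y)$, then $J(H)$ fails the persistence property.
   Context: Let $K$ be a field. A hypergraph $H=(V,E)$ is a finite simple hypergraph (clutter): $V$ is a finite set of vertices, regarded as variables of the polynomial ring $K[V]$, and $E$ is a collection of subsets of $V$ (edges), none contained in another. For $U\subseteq V$, $\mathfrak p_U$ is the prime ideal generated by the variables in $U$. The cover ideal of $H$ is $J(H)=\bigcap_{e\in E}\mathfrak p_e\subseteq K[V]$. For an ideal $I$ of a ring $R$, $\operatorname{ass}(I)$ is the set of prime ideals of the form $(I:f)$, $f\in R$. A hypergraph $H'=(V',E')$ (itself simple) is a shadow of $H=(V,E)$ on $V'$ if $V'\subseteq V$, $E'=\{e\cap V' : e\in E\}$ and $|E'|=|E|$. For $U\subseteq V$, the induced subhypergraph is $H_U=(U,\{e\in E: e\subseteq U\})$. A squarefree monomial ideal $I$ has the persistence property if $\operatorname{ass}(I^s)\subseteq\operatorname{ass}(I^{s+1})$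 for every integer $s>0$; otherwise it fails the persistence property. $J(H')$ and $J(\tilde H)$ are ideals of $K[X]$ and $J(H)$ is an ideal of $K[V]$. A prime $\mathfrak p'$ of $K[X]$ generated by variables is identified with its extension to $K[V]$; $\mathfrak p'+(y)$ is an ideal of $K[V]$. *)

theory Defs
  imports "HOL-Algebra.Ideal_Product" "HOL-Library.Poly_Mapping"
begin

section \<open>Polynomial rings on sets of variables\<close>

text \<open>A polynomial is a finitely supported map from monomials to coefficients, a monomial a
  finitely supported map from variables to exponents.  The type \<^typ>\<open>'v\<close> is only an ambient
  supply of variables; \<open>K[V]\<close> is the subring of the polynomials in which no variable
  outside \<open>V\<close> occurs, so that \<open>K[X]\<close> is literally contained in \<open>K[V]\<close> for \<open>X \<subseteq> V\<close>.\<close>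

type_synonym ('v, 'k) mpoly = "('v \<Rightarrow>\<^sub>0 nat) \<Rightarrow>\<^sub>0 'k"

definition poly_ring :: "'v set \<Rightarrow> ('v, 'k::field) mpoly ring" where
  "poly_ring V = \<lparr>carrier = {p. \<forall>m \<in> Poly_Mapping.keys p. Poly_Mapping.keys m \<subseteq> V},
     mult = (*), one = 1, zero = 0, add = (+)\<rparr>"

definition Var :: "'v \<Rightarrow> ('v, 'k::field) mpoly" where
  "Var v = Poly_Mapping.single (Poly_Mapping.single v 1) 1"

lemma Var_in_poly_ring: "v \<in> V \<Longrightarrow> Var v \<in> carrier (poly_ring V)"
  by (simp add: Var_def poly_ring_def)

lemma poly_ring_cring: "cring (poly_ring V :: ('v, 'k::field) mpoly ring)"
proof -
  have add: "p + q \<in> carrier (poly_ring V)"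
    if "p \<in> carrier (poly_ring V)" "q \<in> carrier (poly_ring V)" for p q :: "('v, 'k) mpoly"
    using that Poly_Mapping.keys_add[of p q] by (auto simp: poly_ring_def)
  have mult: "p * q \<in> carrier (poly_ring V)"
    if p: "p \<in> carrier (poly_ring V)" and q: "q \<in> carrier (poly_ring V)"
    for p q :: "('v, 'k) mpoly"
  proof -
    have "Poly_Mapping.keys m \<subseteq> V" if m: "m \<in> Poly_Mapping.keys (p * q)" for m
    proof -
      obtain a b where ab: "m = a + b" "a \<in> Poly_Mapping.keys p" "b \<in> Poly_Mapping.keys q"
        using m keys_mult[of p q] by blast
      then have "Poly_Mapping.keys a \<subseteq> V" "Poly_Mapping.keys b \<subseteq> V"
        using p q by (simp_all add: poly_ring_def)
      then show ?thesis
        using Poly_Mapping.keys_add[of a b] ab(1) by blast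
    qed
    then show ?thesis by (simp add: poly_ring_def)
  qed
  have inverse: "\<exists>q \<in> carrier (poly_ring V). p + q = 0"
    if "p \<in> carrier (poly_ring V)" for p :: "('v, 'k) mpoly"
    using that by (intro bexI[of _ "- p"]) (simp_all add: poly_ring_def in_keys_iff)
  have zero: "0 \<in> carrier (poly_ring V :: ('v, 'k) mpoly ring)"
    and one: "1 \<in> carrier (poly_ring V :: ('v, 'k) mpoly ring)"
    by (simp_all add: poly_ring_def)
  have ops: "mult (poly_ring V :: ('v, 'k) mpoly ring) = (*)" "one (poly_ring V :: ('v, 'k) mpoly ring) = 1"
    "ring.zero (poly_ring V :: ('v, 'k) mpoly ring) = 0" "add (poly_ring V :: ('v, 'k) mpoly ring) = (+)"
    by (simp_all add: poly_ring_def)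
  show ?thesis
  proof (rule cringI)
    show "abelian_group (poly_ring V :: ('v, 'k) mpoly ring)"
      by (rule abelian_groupI) (simp_all add: ops add zero inverse add.assoc add.commute)
    show "Group.comm_monoid (poly_ring V :: ('v, 'k) mpoly ring)"
      by (rule comm_monoidI) (simp_all add: ops mult one mult.assoc mult.commute)
  qed (simp add: ops distrib_right)
qed


section \<open>Associated primes and persistence\<close>

definition ideal_power :: "('a, 'b) ring_scheme \<Rightarrow> 'a set \<Rightarrow> nat \<Rightarrow> 'a set" where
  "ideal_power R I s = I [^]\<^bsub>ideals_set R\<^esub> s"

definition colon :: "('a, 'b) ring_scheme \<Rightarrow> 'a set \<Rightarrow> 'a \<Rightarrow> 'a set" where
  "colon R I f = {g \<in> carrier R. g \<otimes>\<^bsub>R\<^esub> f \<in> I}"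

definition ass :: "('a, 'b) ring_scheme \<Rightarrow> 'a set \<Rightarrow> 'a set set" where
  "ass R I = {P. primeideal P R \<and> (\<exists>f \<in> carrier R. P = colon R I f)}"

definition persistence_property :: "('a, 'b) ring_scheme \<Rightarrow> 'a set \<Rightarrow> bool" where
  "persistence_property R I \<longleftrightarrow>
     (\<forall>s>0. ass R (ideal_power R I s) \<subseteq> ass R (ideal_power R I (s + 1)))"


section \<open>Hypergraphs and cover ideals\<close>

record 'v hypergraph =
  verts :: "'v set"
  edges :: "'v set set"

definition simple_hypergraph :: "'v hypergraph \<Rightarrow> bool" where
  "simple_hypergraph H \<longleftrightarrow> finite (verts H) \<and> (\<forall>e \<in> edges H. e \<subseteq> verts H) \<and>
     (\<forall>e \<in> edges H. \<forall>e' \<in> edges H. e \<subseteq> e' \<longrightarrow> e = e')"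

definition is_shadow :: "'v hypergraph \<Rightarrow> 'v set \<Rightarrow> 'v hypergraph \<Rightarrow> bool" where
  "is_shadow H V' H' \<longleftrightarrow> simple_hypergraph H' \<and> verts H' = V' \<and> V' \<subseteq> verts H \<and>
     edges H' = (\<lambda>e. e \<inter> V') ` edges H \<and> card (edges H') = card (edges H)"

definition induced_subhypergraph :: "'v hypergraph \<Rightarrow> 'v set \<Rightarrow> 'v hypergraph" where
  "induced_subhypergraph H U = \<lparr>verts = U, edges = {e \<in> edges H. e \<subseteq> U}\<rparr>"

definition var_ideal :: "'v set \<Rightarrow> 'v set \<Rightarrow> ('v, 'k::field) mpoly set" where
  "var_ideal V U = Idl\<^bsub>poly_ring V\<^esub> (Var ` U)"

text \<open>Intersecting with the carrier makes the cover ideal of a hypergraph without edges the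
  unit ideal of \<open>K[V]\<close> (rather than the whole type); otherwise it has no effect.\<close>

definition cover_ideal :: "'v hypergraph \<Rightarrow> ('v, 'k::field) mpoly set" where
  "cover_ideal H = carrier (poly_ring (verts H)) \<inter> (\<Inter>e \<in> edges H. var_ideal (verts H) e)"

end

theory Submission
  imports Defs "HOL-Algebra.QuotRing"
begin

text \<open>Put \<open>J\<^sub>0 = J(H')\<close>, \<open>J\<^sub>1 = J(H\<^sub>X)\<close> and \<open>J = J(H)\<close>, so that \<open>J = J\<^sub>0 + y J\<^sub>1\<close> with
  \<open>J\<^sub>0 \<subseteq> J\<^sub>1\<close>.  The ideals \<open>C\<^sub>k = {a \<in> K[X]. a y\<^sup>k \<in> J\<^sup>s}\<close> increase from \<open>C\<^sub>0 = J\<^sub>0\<^sup>s\<close> to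
  \<open>C\<^sub>s = J\<^sub>1\<^sup>s\<close>.  As \<open>p'\<close> is associated to \<open>C\<^sub>0\<close> but not to \<open>C\<^sub>s\<close>, there is a \<open>k\<close> with
  \<open>p' = (C\<^sub>k : f)\<close> not associated to \<open>C\<^bsub>k+1\<^esub>\<close>.  Then \<open>(C\<^bsub>k+1\<^esub> : f)\<close> strictly contains \<open>p'\<close>;
  multiplying \<open>f\<close> by an element \<open>g \<notin> p'\<close> of it gives \<open>h\<close> with \<open>(C\<^sub>k : h) = p'\<close> and
  \<open>h \<in> C\<^bsub>k+1\<^esub>\<close>, whence \<open>(J\<^sup>s : h y\<^sup>k) = p' + (y)\<close>.

  Conversely, let \<open>p' + (y) = (J\<^bsup>s+1\<^esup> : F)\<close> and let \<open>F\<^sub>0\<close> be the part of \<open>F\<close> free of \<open>y\<close>.  Then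
  \<open>p'\<close> is contained in \<open>(J\<^sub>0\<^bsup>s+1\<^esup> : F\<^sub>0)\<close>, properly because it is not associated to \<open>J\<^sub>0\<^bsup>s+1\<^esup>\<close>, so
  again some \<open>g \<notin> p'\<close> has \<open>g F\<^sub>0 \<in> J\<^bsup>s+1\<^esup>\<close>.  Hence \<open>p' + (y) = (J\<^bsup>s+1\<^esup> : g (F - F\<^sub>0))\<close>, and since
  \<open>y\<close> divides \<open>F - F\<^sub>0\<close>, the prime is associated to \<open>(J\<^bsup>s+1\<^esup> : y)\<close>.\<close>


section \<open>Colons, associated primes and ideal powers\<close>

lemma assI:
  "primeideal P R \<Longrightarrow> f \<in> carrier R \<Longrightarrow> P = colon R I f \<Longrightarrow> P \<in> ass R I"
  by (auto simp: ass_def)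

lemma assE:
  assumes "P \<in> ass R I"
  obtains f where "primeideal P R" and "f \<in> carrier R" and "P = colon R I f"
  using assms by (auto simp: ass_def)

text \<open>Multiplying \<open>f\<close> by \<open>g\<close> turns the condition on \<open>x\<close>
  into \<open>x \<otimes> g\<close> lying in \<open>p\<close>; as \<open>g\<close> is outside the
  prime, this forces \<open>x\<close> into \<open>p\<close>.\<close>

lemma (in cring) colon_mult_prime:
  assumes "primeideal p R" and "f \<in> carrier R" and p: "p = colon R I f"
    and "g \<in> carrier R" and "g \<notin> p"
  shows "colon R I (g \<otimes> f) = p"
proof (rule Set.set_eqI)
  fix x
  interpret p: primeideal p R by fact
  show "x \<in> colon R I (g \<otimes> f) \<longleftrightarrow> x \<in> p"
  proof (cases "x \<in> carrier R")
    case True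
    have "x \<in> colon R I (g \<otimes> f) \<longleftrightarrow> x \<otimes> g \<in> colon R I f"
      using assms(2,4) True by (simp add: colon_def m_assoc)
    also have "\<dots> \<longleftrightarrow> x \<in> p"
      unfolding p[symmetric]
      using p.I_prime[OF True assms(4)] p.I_r_closed[OF _ assms(4)] assms(5) by blast
    finally show ?thesis .
  next
    case False
    then show ?thesis
      using p.a_subset by (auto simp: colon_def)
  qed
qed

text \<open>Equality of \<open>p\<close> with the colon would make \<open>p\<close> associated to
  \<open>I\<close>, so the inclusion is strict and any element of the difference serves as
  \<open>g\<close>.\<close>

lemma (in cring) prime_contains_colon_avoiding:
  assumes "primeideal p R" and "f \<in> carrier R" and "p \<subseteq> colon R I f" and "p \<notin> ass R I"
  obtains g where "g \<in> carrier R" and "g \<notin> p" and "g \<otimes> f \<in> I"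
proof -
  have "p \<noteq> colon R I f"
    using assms by (auto simp: ass_def)
  then show ?thesis
    using assms(3) that by (auto simp: colon_def)
qed

text \<open>Along the chain, \<open>p\<close> must stop being associated at some step
  \<open>k\<close>. The members \<open>C k\<close> need only be increasing sets, so no ideal
  structure has to be checked for them.\<close>

lemma (in cring) ass_chain_jump:
  assumes p: "primeideal p R" and mono: "\<And>k. C k \<subseteq> C (Suc k)"
    and "p \<in> ass R (C 0)" and "p \<notin> ass R (C n)"
  obtains k h where "h \<in> carrier R" and "p = colon R (C k) h" and "h \<in> C (Suc k)"
proof -
  have "\<exists>k. p \<in> ass R (C k) \<and> p \<notin> ass R (C (Suc k))"
    using assms(3,4) by (induction n) auto
  then obtain k f where k: "p \<notin> ass R (C (Suc k))"
    and f: "f \<in> carrier R" "p = colon R (C k) f"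
    by (auto simp: ass_def)
  \<comment> \<open>Enlarging \<open>C k\<close> enlarges the colon by the same \<open>f\<close>.
    The element \<open>g\<close> found outside \<open>p\<close> gives the witness
    \<open>g \<otimes> f\<close>, whose colon at stage \<open>k\<close> is still
    \<open>p\<close>.\<close>
  have "p \<subseteq> colon R (C (Suc k)) f"
    using f(2) mono[of k] by (auto simp: colon_def)
  then obtain g where "g \<in> carrier R" "g \<notin> p" "g \<otimes> f \<in> C (Suc k)"
    using prime_contains_colon_avoiding[OF p f(1) _ k] by blast
  then show thesis
    using that colon_mult_prime[OF p f] f(1) by auto
qed

section \<open>Powers of ideals and their images under homomorphisms\<close>

lemma ideal_power_0 [simp]: "ideal_power R I 0 = carrier R"
  by (simp add: ideal_power_def ideals_set_def nat_pow_def)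

lemma ideal_power_Suc [simp]: "ideal_power R I (Suc n) = ideal_prod R (ideal_power R I n) I"
  by (simp add: ideal_power_def ideals_set_def nat_pow_def)

lemma (in ring) ideal_power_ideal: "ideal I R \<Longrightarrow> ideal (ideal_power R I n) R"
  by (induction n) (simp_all add: oneideal ideal_prod_is_ideal)

text \<open>The twist by \<open>c\<close> makes this cover, besides \<open>h(I) \<subseteq> J\<close>, the inclusion
  \<open>y J(H\<^sub>X) \<subseteq> J(H)\<close>.\<close>

lemma ideal_power_image:
  assumes "cring R" and "cring S" and h: "h \<in> ring_hom R S"
    and I: "ideal I R" and J: "ideal J S" and c: "c \<in> carrier S"
    and step: "\<And>a. a \<in> I \<Longrightarrow> h a \<otimes>\<^bsub>S\<^esub> c \<in> J"
    and "a \<in> ideal_power R I n"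
  shows "h a \<otimes>\<^bsub>S\<^esub> c [^]\<^bsub>S\<^esub> n \<in> ideal_power S J n"
  using assms(8)
proof (induction n arbitrary: a)
  case 0
  interpret S: cring S by fact
  show ?case
    using 0 ring_hom_closed[OF h] by simp
next
  case (Suc n)
  interpret R: cring R by fact
  interpret S: cring S by fact
  interpret P: ideal "ideal_power R I n" R
    by (rule R.ideal_power_ideal[OF I])
  interpret I: ideal I R by fact
  have sub: "ideal_prod R (ideal_power R I n) I \<subseteq> carrier R"
    by (rule R.ideal_prod_in_carrier[OF P.is_ideal I])
  from Suc.prems[simplified] show ?case
  proof induction
    case (prod i j)
    have ij: "i \<in> carrier R" "j \<in> carrier R"
      using prod P.a_subset I.a_subset by auto
    \<comment> \<open>Each factor taken from \<open>I\<close> brings one factor \<open>c\<close>;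
      regrouping collects them into \<open>c\<close> to the power \<open>Suc n\<close>.\<close>
    have "(h i \<otimes>\<^bsub>S\<^esub> c [^]\<^bsub>S\<^esub> n) \<otimes>\<^bsub>S\<^esub> (h j \<otimes>\<^bsub>S\<^esub> c) \<in> ideal_power S J (Suc n)"
      using Suc.IH[OF prod(1)] step[OF prod(2)] by (auto intro: ideal_prod.prod)
    also have "(h i \<otimes>\<^bsub>S\<^esub> c [^]\<^bsub>S\<^esub> n) \<otimes>\<^bsub>S\<^esub> (h j \<otimes>\<^bsub>S\<^esub> c)
        = h (i \<otimes>\<^bsub>R\<^esub> j) \<otimes>\<^bsub>S\<^esub> c [^]\<^bsub>S\<^esub> Suc n"
      using ij c ring_hom_closed[OF h] by (simp add: ring_hom_mult[OF h] S.m_ac)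
    finally show ?case .
  next
    case (sum a b)
    have ab: "a \<in> carrier R" "b \<in> carrier R"
      using sum sub by auto
    then have "h (a \<oplus>\<^bsub>R\<^esub> b) \<otimes>\<^bsub>S\<^esub> c [^]\<^bsub>S\<^esub> Suc n
        = h a \<otimes>\<^bsub>S\<^esub> c [^]\<^bsub>S\<^esub> Suc n \<oplus>\<^bsub>S\<^esub> h b \<otimes>\<^bsub>S\<^esub> c [^]\<^bsub>S\<^esub> Suc n"
      using c ring_hom_closed[OF h] by (simp add: ring_hom_add[OF h] S.l_distr)
    then show ?case
      using sum.IH by (simp add: ideal_prod.sum)
  qed
qed


section \<open>Substituting a constant for a variable\<close>

lemma poly_ring_simps [simp]:
  "mult (poly_ring V) = (*)" "one (poly_ring V) = 1"
  "ring.zero (poly_ring V) = 0" "add (poly_ring V) = (+)"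
  by (simp_all add: poly_ring_def)

lemma poly_ring_ring: "ring (poly_ring V :: ('v, 'k::field) mpoly ring)"
  using poly_ring_cring by (rule cring.axioms)

lemma poly_ring_mono: "X \<subseteq> V \<Longrightarrow> carrier (poly_ring X) \<subseteq> carrier (poly_ring V)"
  by (auto simp: poly_ring_def)

lemma poly_ring_a_inv:
  assumes "p \<in> carrier (poly_ring V :: ('v, 'k::field) mpoly ring)"
  shows "\<ominus>\<^bsub>poly_ring V\<^esub> p = - p"
proof -
  interpret R: cring "poly_ring V :: ('v, 'k) mpoly ring"
    by (rule poly_ring_cring)
  have "- p \<in> carrier (poly_ring V)"
    using assms by (simp add: poly_ring_def)
  then show ?thesis
    using assms by (intro R.minus_equality) auto
qed

lemma poly_ring_pow: "p [^]\<^bsub>poly_ring V\<^esub> (n::nat) = p ^ n"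
  unfolding nat_pow_def by (induction n) (simp_all add: power_Suc2 del: power_Suc)

lemma poly_ring_ideal_diff:
  assumes "ideal I (poly_ring V :: ('v, 'k::field) mpoly ring)" and "a \<in> I" and "b \<in> I"
  shows "a - b \<in> I"
proof -
  interpret I: ideal I "poly_ring V :: ('v, 'k) mpoly ring" by fact
  have "\<ominus>\<^bsub>poly_ring V\<^esub> b \<in> I"
    by (rule additive_subgroup.a_inv_closed[OF I.is_additive_subgroup assms(3)])
  then have "- b \<in> I"
    using poly_ring_a_inv[of b V] assms(3) I.a_subset by auto
  then show ?thesis
    using additive_subgroup.a_closed[OF I.is_additive_subgroup assms(2), of "- b"] by simp
qed

lemma poly_ring_ideal_add_iff:
  assumes "ideal I (poly_ring V :: ('v, 'k::field) mpoly ring)" and "b \<in> I"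
  shows "a + b \<in> I \<longleftrightarrow> a \<in> I"
proof -
  interpret I: ideal I "poly_ring V :: ('v, 'k) mpoly ring" by fact
  show ?thesis
    using poly_ring_ideal_diff[OF assms(1) _ assms(2), of "a + b"]
      additive_subgroup.a_closed[OF I.is_additive_subgroup _ assms(2), of a] by auto
qed

text \<open>Evaluation at \<open>y = c\<close>: \<open>update y 0\<close> erases \<open>y\<close>
  from a monomial, and the power of \<open>c\<close> that replaces it moves into the coefficient.
  The result stays in the same type, so \<open>K[X]\<close> needs no separate embedding.\<close>

definition subst_const :: "'v \<Rightarrow> 'k \<Rightarrow> ('v, 'k::field) mpoly \<Rightarrow> ('v, 'k) mpoly" where
  "subst_const y c F = (\<Sum>m\<in>Poly_Mapping.keys F. Poly_Mapping.single (Poly_Mapping.update y 0 m)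
      (Poly_Mapping.lookup F m * c ^ Poly_Mapping.lookup m y))"

text \<open>Terms outside the support vanish. A common index set for \<open>F\<close>,
  \<open>G\<close> and \<open>F + G\<close> is what makes additivity immediate, even when terms
  cancel.\<close>

lemma subst_const_superset:
  assumes "finite A" and "Poly_Mapping.keys F \<subseteq> A"
  shows "subst_const y c F = (\<Sum>m\<in>A. Poly_Mapping.single (Poly_Mapping.update y 0 m)
      (Poly_Mapping.lookup F m * c ^ Poly_Mapping.lookup m y))"
  unfolding subst_const_def using assms
  by (intro sum.mono_neutral_left) (auto simp: in_keys_iff)

lemma subst_const_add: "subst_const y c (F + G) = subst_const y c F + subst_const y c G"
proof -
  let ?A = "Poly_Mapping.keys F \<union> Poly_Mapping.keys G"
  have "Poly_Mapping.keys (F + G) \<subseteq> ?A"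
    by (rule Poly_Mapping.keys_add)
  then show ?thesis
    by (simp add: subst_const_superset[of ?A] lookup_add distrib_right single_add sum.distrib)
qed

lemma subst_const_0 [simp]: "subst_const y c 0 = 0"
  by (simp add: subst_const_def)

lemma subst_const_single:
  "subst_const y c (Poly_Mapping.single m a)
    = Poly_Mapping.single (Poly_Mapping.update y 0 m) (a * c ^ Poly_Mapping.lookup m y)"
  by (simp add: subst_const_def)

text \<open>The library induction adds a key by \<open>update\<close>; rephrasing it as adding a
  monomial suits maps known to be additive.\<close>

lemma mpoly_induct [case_names zero add]:
  fixes F :: "('v, 'k::field) mpoly"
  assumes "P 0"
    and "\<And>F m a. m \<notin> Poly_Mapping.keys F \<Longrightarrow> a \<noteq> 0 \<Longrightarrow> P F \<Longrightarrow> P (Poly_Mapping.single m a + F)"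
  shows "P F"
proof (induction F rule: update_induct)
  case const
  show ?case by fact
next
  case (update F m a)
  have "Poly_Mapping.update m a F = Poly_Mapping.single m a + F"
    using update(1)
    by (intro poly_mapping_eqI) (auto simp: lookup_update lookup_add lookup_single when_def in_keys_iff)
  then show ?case
    using assms(2)[OF update] by simp
qed

text \<open>Both sides are additive in \<open>F\<close> and in \<open>G\<close>, so two nested
  inductions reduce the claim to a product of two monomials.\<close>

lemma subst_const_mult: "subst_const y c (F * G) = subst_const y c F * subst_const y c G"
proof (induction F rule: mpoly_induct)
  case (add F m a)
  have "subst_const y c (Poly_Mapping.single m a * G)
      = subst_const y c (Poly_Mapping.single m a) * subst_const y c G"
  proof (induction G rule: mpoly_induct)
    case (add G l b)
    have "Poly_Mapping.update y 0 (m + l) = Poly_Mapping.update y 0 m + Poly_Mapping.update y 0 l"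
      by (intro poly_mapping_eqI) (simp add: lookup_update lookup_add)
    then have "subst_const y c (Poly_Mapping.single m a * Poly_Mapping.single l b)
        = subst_const y c (Poly_Mapping.single m a) * subst_const y c (Poly_Mapping.single l b)"
      by (simp add: mult_single subst_const_single lookup_add power_add ac_simps)
    then show ?case
      using add by (simp add: distrib_left subst_const_add)
  qed simp
  then show ?case
    using add by (simp add: distrib_right subst_const_add)
qed simp

lemma keys_update_0: "Poly_Mapping.keys (Poly_Mapping.update y 0 m) = Poly_Mapping.keys m - {y}"
  by (auto simp: in_keys_iff lookup_update split: if_splits)

lemma subst_const_ident:
  assumes "F \<in> carrier (poly_ring X)" and "y \<notin> X"
  shows "subst_const y c F = F"
proof -
  have "Poly_Mapping.single (Poly_Mapping.update y 0 m)
      (Poly_Mapping.lookup F m * c ^ Poly_Mapping.lookup m y)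
      = Poly_Mapping.single m (Poly_Mapping.lookup F m)"
    if "m \<in> Poly_Mapping.keys F" for m
  proof -
    have "y \<notin> Poly_Mapping.keys m"
      using assms that by (auto simp: poly_ring_def)
    then have "Poly_Mapping.lookup m y = 0"
      by (simp add: in_keys_iff)
    moreover from this have "Poly_Mapping.update y 0 m = m"
      by (intro poly_mapping_eqI) (auto simp: lookup_update)
    ultimately show ?thesis by simp
  qed
  then have "subst_const y c F
      = (\<Sum>m\<in>Poly_Mapping.keys F. Poly_Mapping.single m (Poly_Mapping.lookup F m))"
    by (simp add: subst_const_def)
  also have "\<dots> = F"
    by (intro poly_mapping_eqI)
      (simp add: lookup_sum lookup_single when_def in_keys_iff if_distrib[of "\<lambda>b. b = _"] cong: if_cong)
  finally show ?thesis .
qed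

lemma subst_const_Var_same [simp]: "subst_const y c (Var y) = Poly_Mapping.single 0 c"
proof -
  have "Poly_Mapping.update y 0 (Poly_Mapping.single y (1::nat)) = 0"
    by (intro poly_mapping_eqI) (simp add: lookup_update lookup_single)
  then show ?thesis
    by (simp add: Var_def subst_const_single)
qed

lemma subst_const_Var_other: "v \<noteq> y \<Longrightarrow> subst_const y c (Var v) = Var v"
  by (rule subst_const_ident[of _ "{v}"]) (simp_all add: Var_in_poly_ring)

lemma subst_const_carrier:
  assumes "F \<in> carrier (poly_ring (insert y X))"
  shows "subst_const y c F \<in> carrier (poly_ring X)"
proof -
  have "Poly_Mapping.keys m \<subseteq> X"
    if m: "m \<in> Poly_Mapping.keys (subst_const y c F)" for m
  proof -
    obtain l where "l \<in> Poly_Mapping.keys F" "m = Poly_Mapping.update y 0 l"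
      using m unfolding subst_const_def
      by (auto dest!: subsetD[OF keys_sum] split: if_splits)
    then show ?thesis
      using assms by (auto simp: keys_update_0 poly_ring_def)
  qed
  then show ?thesis by (simp add: poly_ring_def)
qed

lemma subst_const_ring_hom:
  "subst_const y c \<in> ring_hom (poly_ring (insert y X)) (poly_ring X)"
proof (rule ring_hom_memI)
  show "subst_const y c \<one>\<^bsub>poly_ring (insert y X)\<^esub> = \<one>\<^bsub>poly_ring X\<^esub>"
    using subst_const_ident[of 1 "{}"] by (simp add: poly_ring_def)
qed (simp_all add: subst_const_carrier subst_const_mult subst_const_add)

text \<open>Monomials free of \<open>y\<close> are fixed by \<open>y = 0\<close>, and all others are
  multiples of \<open>y\<close> that vanish there.\<close>

lemma subst_const_0_decomp:
  fixes F :: "('v, 'k::field) mpoly"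
  assumes "F \<in> carrier (poly_ring (insert y X))"
  obtains G where "G \<in> carrier (poly_ring (insert y X))" and "F = subst_const y 0 F + G * Var y"
proof -
  have "\<exists>G\<in>carrier (poly_ring (insert y X)). F = subst_const y 0 F + G * Var y"
    using assms
  proof (induction F rule: mpoly_induct)
    case zero
    show ?case by (rule bexI[of _ 0]) (simp_all add: poly_ring_def)
  next
    case (add F m a)
    have keys: "Poly_Mapping.keys (Poly_Mapping.single m a + F) = insert m (Poly_Mapping.keys F)"
      using add(1,2) by (auto simp: in_keys_iff lookup_add lookup_single when_def split: if_splits)
    have "F \<in> carrier (poly_ring (insert y X))" and m: "Poly_Mapping.keys m \<subseteq> insert y X"
      using add.prems by (simp_all add: poly_ring_def keys)
    then obtain G where G: "G \<in> carrier (poly_ring (insert y X))"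
      "F = subst_const y 0 F + G * Var y"
      using add.IH by blast
    have "\<exists>M\<in>carrier (poly_ring (insert y X)).
        Poly_Mapping.single m a = subst_const y 0 (Poly_Mapping.single m a) + M * Var y"
    proof (cases "Poly_Mapping.lookup m y = 0")
      case True
      then have "Poly_Mapping.update y 0 m = m"
        by (intro poly_mapping_eqI) (auto simp: lookup_update)
      then show ?thesis
        using True by (intro bexI[of _ 0]) (simp_all add: subst_const_single poly_ring_def)
    next
      case False
      \<comment> \<open>The monomial divided by \<open>y\<close>; the truncated subtraction is exact
        because the exponent of \<open>y\<close> is nonzero.\<close>
      let ?M = "Poly_Mapping.single (m - Poly_Mapping.single y 1) a"
      have "m - Poly_Mapping.single y 1 + Poly_Mapping.single y 1 = m"
        using False
        by (intro poly_mapping_eqI) (auto simp: lookup_add lookup_minus lookup_single when_def)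
      then have "Poly_Mapping.single m a = subst_const y 0 (Poly_Mapping.single m a) + ?M * Var y"
        using False by (simp add: subst_const_single Var_def mult_single power_0_left)
      moreover have "Poly_Mapping.keys (m - Poly_Mapping.single y 1) \<subseteq> Poly_Mapping.keys m"
        by (auto simp: in_keys_iff lookup_minus)
      then have "?M \<in> carrier (poly_ring (insert y X))"
        using m by (simp add: poly_ring_def) blast
      ultimately show ?thesis by blast
    qed
    then obtain M where "M \<in> carrier (poly_ring (insert y X))"
      "Poly_Mapping.single m a = subst_const y 0 (Poly_Mapping.single m a) + M * Var y" by blast
    then show ?case
      using G cring.cring_simprules(1)[OF poly_ring_cring, of M "insert y X" G]
      by (intro bexI[of _ "M + G"]) (auto simp: subst_const_add algebra_simps)
  qed
  then show thesis using that by blast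
qed
lemma subst_const_ring_hom_ring:
  "ring_hom_ring (poly_ring (insert y X)) (poly_ring X) (subst_const y c)"
  by (intro ring_hom_ringI2 poly_ring_ring subst_const_ring_hom)

lemma poly_ring_inclusion_ring_hom:
  "X \<subseteq> V \<Longrightarrow> (\<lambda>p. p) \<in> ring_hom (poly_ring X) (poly_ring V)"
  using poly_ring_mono by (intro ring_hom_memI) auto


section \<open>Primes and powers along the extension by one variable\<close>

abbreviation (input) adjoin_var :: "'v set \<Rightarrow> 'v \<Rightarrow> ('v, 'k::field) mpoly set \<Rightarrow> ('v, 'k) mpoly set" where
  "adjoin_var V y p \<equiv> Idl\<^bsub>poly_ring V\<^esub> p <+>\<^bsub>poly_ring V\<^esub> PIdl\<^bsub>poly_ring V\<^esub> (Var y)"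

text \<open>Describing \<open>p + (y)\<close> as the preimage of \<open>p\<close> under
  \<open>y = 0\<close> yields both its primality and a membership test that avoids ideal
  generators.\<close>

lemma adjoin_var_eq_vimage:
  fixes p :: "('v, 'k::field) mpoly set"
  assumes "y \<notin> X" and p: "ideal p (poly_ring X)"
  shows "adjoin_var (insert y X) y p
    = {F \<in> carrier (poly_ring (insert y X)). subst_const y 0 F \<in> p}" (is "_ = ?Q")
proof -
  let ?S = "poly_ring (insert y X) :: ('v, 'k) mpoly ring"
  interpret S: cring ?S by (rule poly_ring_cring)
  interpret p: ideal p "poly_ring X" by fact
  interpret h: ring_hom_ring ?S "poly_ring X" "subst_const y 0"
    by (rule subst_const_ring_hom_ring)
  have Q: "ideal ?Q ?S"
    by (rule h.ideal_vimage[OF p])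
  have pX: "p \<subseteq> carrier (poly_ring X)"
    using p.Icarr by auto
  then have pS: "p \<subseteq> carrier ?S"
    using poly_ring_mono[of X "insert y X"] by blast
  have y: "Var y \<in> carrier ?S"
    by (simp add: Var_in_poly_ring)
  have I: "ideal (Idl\<^bsub>?S\<^esub> p) ?S" and J: "ideal (PIdl\<^bsub>?S\<^esub> (Var y)) ?S"
    by (rule S.genideal_ideal[OF pS], rule S.cgenideal_ideal[OF y])
  have "Idl\<^bsub>?S\<^esub> p \<subseteq> ?Q"
  proof (rule S.genideal_minimal[OF Q], rule subsetI)
    fix a assume "a \<in> p"
    then show "a \<in> ?Q"
      using pX pS subst_const_ident[of a X y 0] assms(1) by auto
  qed
  moreover have "PIdl\<^bsub>?S\<^esub> (Var y) \<subseteq> ?Q"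
    using y additive_subgroup.zero_closed[OF p.is_additive_subgroup]
    by (intro S.cgenideal_minimal[OF Q]) simp
  ultimately have "adjoin_var (insert y X) y p \<subseteq> ?Q"
    unfolding S.union_genideal[OF I J, symmetric]
    by - (rule S.genideal_minimal[OF Q], rule Un_least)
  moreover have "?Q \<subseteq> adjoin_var (insert y X) y p"
  proof
    fix F assume F: "F \<in> ?Q"
    then obtain G where G: "G \<in> carrier ?S" "F = subst_const y 0 F + G * Var y"
      by (auto elim: subst_const_0_decomp)
    have "subst_const y 0 F \<in> Idl\<^bsub>?S\<^esub> p"
      using F S.genideal_self[OF pS] by auto
    moreover have "G * Var y \<in> PIdl\<^bsub>?S\<^esub> (Var y)"
      using ideal.I_l_closed[OF J S.cgenideal_self[OF y] G(1)] by simp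
    ultimately show "F \<in> adjoin_var (insert y X) y p"
      using G(2) unfolding set_add_def' by auto
  qed
  ultimately show ?thesis by blast
qed

lemma adjoin_var_prime:
  assumes "y \<notin> X" and "primeideal p (poly_ring X)"
  shows "primeideal (adjoin_var (insert y X) y p) (poly_ring (insert y X))"
  unfolding adjoin_var_eq_vimage[OF assms(1) primeideal.axioms(1)[OF assms(2)]]
  by (rule ring_hom_ring.primeideal_vimage[OF subst_const_ring_hom_ring poly_ring_cring assms(2)])

text \<open>The hypotheses encode \<open>J = J\<^sub>0 + y J\<^sub>1\<close> over \<open>K[X]\<close>, where \<open>J\<^sub>0 \<subseteq> J\<^sub>1\<close>, without
  decomposing into \<open>y\<close>-degrees: \<open>y = 0\<close> reads off the degree \<open>0\<close> part, and \<open>y = 1\<close> adds up all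
  parts.\<close>

locale cone_ideal =
  fixes X :: "'v set" and y :: 'v and J\<^sub>0 J\<^sub>1 J :: "('v, 'k::field) mpoly set"
  assumes y: "y \<notin> X"
    and J\<^sub>0: "ideal J\<^sub>0 (poly_ring X)" and J\<^sub>1: "ideal J\<^sub>1 (poly_ring X)"
    and J: "ideal J (poly_ring (insert y X))"
    and J\<^sub>0_sub: "J\<^sub>0 \<subseteq> J" and J\<^sub>1_sub: "\<And>a. a \<in> J\<^sub>1 \<Longrightarrow> a * Var y \<in> J"
    and subst_0: "\<And>F. F \<in> J \<Longrightarrow> subst_const y 0 F \<in> J\<^sub>0"
    and subst_1: "\<And>F. F \<in> J \<Longrightarrow> subst_const y 1 F \<in> J\<^sub>1"
begin

abbreviation "R \<equiv> poly_ring X :: ('v, 'k) mpoly ring"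
abbreviation "S \<equiv> poly_ring (insert y X) :: ('v, 'k) mpoly ring"

sublocale R: cring R by (rule poly_ring_cring)
sublocale S: cring S by (rule poly_ring_cring)

lemma carrier_mono: "carrier R \<subseteq> carrier S"
  by (rule poly_ring_mono) auto

lemma Var_y: "Var y \<in> carrier S"
  by (simp add: Var_in_poly_ring)

lemma Var_y_pow: "Var y ^ k \<in> carrier S"
  using S.nat_pow_closed[OF Var_y, of k] by (simp add: poly_ring_pow)

lemma power_J: "ideal (ideal_power S J n) S"
  by (rule S.ideal_power_ideal[OF J])

lemma power_J\<^sub>0_sub: "ideal_power R J\<^sub>0 n \<subseteq> ideal_power S J n"
  using ideal_power_image[OF R.is_cring S.is_cring poly_ring_inclusion_ring_hom J\<^sub>0 J, of 1] J\<^sub>0_sub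
    S.one_closed by (auto simp: poly_ring_pow)

text \<open>The twist is \<open>c = Var y\<close> here, one factor for each of the \<open>n\<close>
  factors from \<open>J\<^sub>1\<close>; the neighbouring lemmas use \<open>c = 1\<close>.\<close>

lemma power_J\<^sub>1_sub: "a \<in> ideal_power R J\<^sub>1 n \<Longrightarrow> a * Var y ^ n \<in> ideal_power S J n"
  using ideal_power_image[OF R.is_cring S.is_cring poly_ring_inclusion_ring_hom J\<^sub>1 J Var_y] J\<^sub>1_sub
  by (auto simp: poly_ring_pow)

lemma power_subst_0: "F \<in> ideal_power S J n \<Longrightarrow> subst_const y 0 F \<in> ideal_power R J\<^sub>0 n"
  using ideal_power_image[OF S.is_cring R.is_cring subst_const_ring_hom J J\<^sub>0 R.one_closed, of 0 F n] subst_0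
  by (simp add: poly_ring_pow)

lemma power_subst_1: "F \<in> ideal_power S J n \<Longrightarrow> subst_const y 1 F \<in> ideal_power R J\<^sub>1 n"
  using ideal_power_image[OF S.is_cring R.is_cring subst_const_ring_hom J J\<^sub>1 R.one_closed, of 1 F n] subst_1
  by (simp add: poly_ring_pow)

lemma subst_const_shift:
  assumes "a \<in> carrier R"
  shows "subst_const y 1 (a * Var y ^ k) = a"
proof -
  have "subst_const y 1 (Var y ^ k) = (1 :: ('v, 'k) mpoly)"
  proof (induction k)
    case 0
    show ?case
      using subst_const_ident[of 1 "{}" y 1] by (simp add: poly_ring_def)
  qed (simp add: subst_const_mult)
  then show ?thesis
    using subst_const_ident[OF assms y] by (simp add: subst_const_mult)
qed

lemma adjoin_var_in_ass:
  assumes p: "primeideal p R"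
    and "p \<in> ass R (ideal_power R J\<^sub>0 n)" and "p \<notin> ass R (ideal_power R J\<^sub>1 n)"
  shows "adjoin_var (insert y X) y p \<in> ass S (ideal_power S J n)"
proof -
  interpret P: ideal "ideal_power S J n" S by (rule power_J)
  define C where "C k = {a \<in> carrier R. a * Var y ^ k \<in> ideal_power S J n}" for k
  \<comment> \<open>An element of \<open>K[X]\<close> is fixed by \<open>y = 0\<close>, which
    carries powers of \<open>J\<close> into powers of \<open>J\<^sub>0\<close>.\<close>
  have "C 0 = ideal_power R J\<^sub>0 n"
  proof (rule Set.set_eqI)
    fix a
    have "a \<in> ideal_power S J n \<Longrightarrow> a \<in> carrier R \<Longrightarrow> a \<in> ideal_power R J\<^sub>0 n"
      using power_subst_0[of a n] subst_const_ident[of a X y 0] y by simp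
    then show "a \<in> C 0 \<longleftrightarrow> a \<in> ideal_power R J\<^sub>0 n"
      using power_J\<^sub>0_sub ideal.Icarr[OF R.ideal_power_ideal[OF J\<^sub>0], of a n]
      by (auto simp: C_def)
  qed
  \<comment> \<open>Here \<open>y = 1\<close> recovers \<open>a\<close> from its product with
    \<open>Var y ^ n\<close>, and carries powers of \<open>J\<close> into powers of
    \<open>J\<^sub>1\<close>.\<close>
  moreover have "C n = ideal_power R J\<^sub>1 n"
  proof (rule Set.set_eqI)
    fix a
    have "a * Var y ^ n \<in> ideal_power S J n \<Longrightarrow> a \<in> carrier R \<Longrightarrow> a \<in> ideal_power R J\<^sub>1 n"
      using power_subst_1[of "a * Var y ^ n" n] subst_const_shift[of a n] by simp
    then show "a \<in> C n \<longleftrightarrow> a \<in> ideal_power R J\<^sub>1 n"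
      using power_J\<^sub>1_sub[of a n] ideal.Icarr[OF R.ideal_power_ideal[OF J\<^sub>1], of a n]
      by (auto simp: C_def)
  qed
  ultimately have "p \<in> ass R (C 0)" and "p \<notin> ass R (C n)"
    using assms(2,3) by simp_all
  moreover have mono: "C k \<subseteq> C (Suc k)" for k
  proof
    fix a assume "a \<in> C k"
    then show "a \<in> C (Suc k)"
      using P.I_r_closed[OF _ Var_y, of "a * Var y ^ k"] by (simp add: C_def ac_simps)
  qed
  ultimately obtain k h where h: "h \<in> carrier R" "p = colon R (C k) h" "h \<in> C (Suc k)"
    using R.ass_chain_jump[where C = C and n = n, OF p mono] by blast
  have hy: "h * Var y ^ k \<in> carrier S"
    using S.m_closed[of h "Var y ^ k"] h(1) carrier_mono Var_y_pow by auto
  have "F * (h * Var y ^ k) \<in> ideal_power S J n \<longleftrightarrow> subst_const y 0 F \<in> p"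
    if F: "F \<in> carrier S" for F
  proof -
    obtain G where G: "G \<in> carrier S" "F = subst_const y 0 F + G * Var y"
      using F by (rule subst_const_0_decomp)
    have F0: "subst_const y 0 F \<in> carrier R"
      using F by (rule subst_const_carrier)
    \<comment> \<open>Since \<open>h\<close> lies in \<open>C (Suc k)\<close>, the part of
      \<open>F\<close> divisible by \<open>y\<close> contributes an element of the power; only the
      value of \<open>F\<close> at \<open>y = 0\<close> decides membership.\<close>
    have "F * (h * Var y ^ k)
        = subst_const y 0 F * h * Var y ^ k + G * (h * Var y ^ Suc k)"
      by (subst G(2)) (simp add: algebra_simps)
    moreover have "G * (h * Var y ^ Suc k) \<in> ideal_power S J n"
      using h(3) P.I_l_closed[OF _ G(1)] by (simp add: C_def)
    ultimately have "F * (h * Var y ^ k) \<in> ideal_power S J n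
        \<longleftrightarrow> subst_const y 0 F * h * Var y ^ k \<in> ideal_power S J n"
      by (simp add: poly_ring_ideal_add_iff[OF power_J])
    then show ?thesis
      using h(1,2) F0 R.m_closed[OF F0 h(1)] by (simp add: colon_def C_def)
  qed
  then have "adjoin_var (insert y X) y p = colon S (ideal_power S J n) (h * Var y ^ k)"
    unfolding adjoin_var_eq_vimage[OF y primeideal.axioms(1)[OF p]] by (auto simp: colon_def)
  then show ?thesis
    by (rule assI[OF adjoin_var_prime[OF y p] hy])
qed

lemma adjoin_var_not_in_ass:
  assumes p: "primeideal p R" and "p \<notin> ass R (ideal_power R J\<^sub>0 n)"
    and colon_y: "adjoin_var (insert y X) y p \<notin> ass S (colon S (ideal_power S J n) (Var y))"
  shows "adjoin_var (insert y X) y p \<notin> ass S (ideal_power S J n)"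
proof
  let ?P = "adjoin_var (insert y X) y p"
  interpret P: ideal "ideal_power S J n" S by (rule power_J)
  have P: "?P = {F \<in> carrier S. subst_const y 0 F \<in> p}"
    by (rule adjoin_var_eq_vimage[OF y primeideal.axioms(1)[OF p]])
  have prime: "primeideal ?P S"
    by (rule adjoin_var_prime[OF y p])
  assume "?P \<in> ass S (ideal_power S J n)"
  then obtain F where F: "F \<in> carrier S" "?P = colon S (ideal_power S J n) F"
    by (rule assE)
  have F0: "subst_const y 0 F \<in> carrier R"
    using F(1) by (rule subst_const_carrier)
  \<comment> \<open>Put \<open>y = 0\<close> in the relation that \<open>a * F\<close> lies in the
    power of \<open>J\<close>; the factor \<open>a\<close> is unchanged.\<close>
  have "p \<subseteq> colon R (ideal_power R J\<^sub>0 n) (subst_const y 0 F)"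
  proof
    fix a assume a: "a \<in> p"
    then have aR: "a \<in> carrier R"
      using ideal.Icarr[OF primeideal.axioms(1)[OF p]] by blast
    then have "a \<in> ?P"
      unfolding P using a carrier_mono by (simp add: subst_const_ident[OF aR y] subsetD)
    then have "a * F \<in> ideal_power S J n"
      unfolding F(2) by (simp add: colon_def)
    then show "a \<in> colon R (ideal_power R J\<^sub>0 n) (subst_const y 0 F)"
      using power_subst_0[of "a * F" n] subst_const_ident[OF aR y] aR
      by (simp add: subst_const_mult colon_def)
  qed
  then obtain g where g: "g \<in> carrier R" "g \<notin> p" "g * subst_const y 0 F \<in> ideal_power R J\<^sub>0 n"
    by (rule R.prime_contains_colon_avoiding[OF p F0 _ assms(2)]) simp
  have gS: "g \<in> carrier S"
    using g(1) carrier_mono by blast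
  have "g \<notin> ?P"
    unfolding P using g(2) by (simp add: subst_const_ident[OF g(1) y])
  then have P_gF: "colon S (ideal_power S J n) (g * F) = ?P"
    using S.colon_mult_prime[OF prime F gS] by simp
  obtain G where G: "G \<in> carrier S" "F = subst_const y 0 F + G * Var y"
    using F(1) by (rule subst_const_0_decomp)
  \<comment> \<open>By the choice of \<open>g\<close>, the part of \<open>g * F\<close> free of
    \<open>y\<close> already lies in the power, leaving a multiple of \<open>Var y\<close>.\<close>
  have "x * (g * F) \<in> ideal_power S J n \<longleftrightarrow> x * (g * G) * Var y \<in> ideal_power S J n"
    if x: "x \<in> carrier S" for x
  proof -
    have "x * (g * F) = x * (g * G) * Var y + x * (g * subst_const y 0 F)"
      by (subst G(2)) (simp add: algebra_simps)
    moreover have "x * (g * subst_const y 0 F) \<in> ideal_power S J n"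
      using P.I_l_closed[OF subsetD[OF power_J\<^sub>0_sub g(3)] x] by simp
    ultimately show ?thesis
      by (simp add: poly_ring_ideal_add_iff[OF power_J])
  qed
  moreover have gG: "g * G \<in> carrier S"
    using S.m_closed[OF gS G(1)] by simp
  ultimately have "colon S (ideal_power S J n) (g * F)
      = colon S (colon S (ideal_power S J n) (Var y)) (g * G)"
    using S.m_closed[OF _ gG] by (auto simp: colon_def)
  then have "?P \<in> ass S (colon S (ideal_power S J n) (Var y))"
    unfolding P_gF
    by (rule assI[OF prime gG])
  then show False
    using colon_y by contradiction
qed

end


section \<open>Cover ideals\<close>

lemma var_ideal_ideal:
  "U \<subseteq> V \<Longrightarrow> ideal (var_ideal V U :: ('v, 'k::field) mpoly set) (poly_ring V)"
  unfolding var_ideal_def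
  by (intro ring.genideal_ideal[OF poly_ring_ring]) (auto intro: Var_in_poly_ring)

lemma Var_in_var_ideal:
  assumes "v \<in> U" and "U \<subseteq> V"
  shows "Var v \<in> var_ideal V U"
proof -
  have "Var ` U \<subseteq> carrier (poly_ring V)"
    using assms(2) by (auto intro: Var_in_poly_ring)
  then show ?thesis
    unfolding var_ideal_def
    using ring.genideal_self[OF poly_ring_ring] assms(1) by blast
qed

lemma cover_ideal_ideal:
  assumes "\<And>e. e \<in> edges H \<Longrightarrow> e \<subseteq> verts H"
  shows "ideal (cover_ideal H :: ('v, 'k::field) mpoly set) (poly_ring (verts H))"
proof -
  let ?R = "poly_ring (verts H) :: ('v, 'k) mpoly ring"
  interpret R: cring ?R by (rule poly_ring_cring)
  \<comment> \<open>The carrier keeps the intersected family nonempty when there are no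
    edges.\<close>
  have "ideal (\<Inter>(insert (carrier ?R) (var_ideal (verts H) ` edges H))) ?R"
  proof (rule R.i_Intersect)
    fix I assume "I \<in> insert (carrier ?R) (var_ideal (verts H) ` edges H)"
    then show "ideal I ?R"
      using assms R.oneideal by (auto intro: var_ideal_ideal)
  qed simp
  then show ?thesis
    by (simp add: cover_ideal_def)
qed

text \<open>The preimage of an ideal is an ideal, so it suffices to test the generators.\<close>

lemma ring_hom_var_ideal:
  assumes h: "h \<in> ring_hom (poly_ring V) (poly_ring W)" and "U \<subseteq> V" and "U' \<subseteq> W"
    and "\<And>v. v \<in> U \<Longrightarrow> h (Var v) \<in> var_ideal W U'"
    and "F \<in> var_ideal V U"
  shows "h F \<in> var_ideal W U'"
proof -
  interpret h: ring_hom_ring "poly_ring V" "poly_ring W" h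
    by (intro ring_hom_ringI2 poly_ring_ring h)
  have "ideal {F \<in> carrier (poly_ring V). h F \<in> var_ideal W U'} (poly_ring V)"
    by (rule h.ideal_vimage[OF var_ideal_ideal[OF assms(3)]])
  then have "var_ideal V U \<subseteq> {F \<in> carrier (poly_ring V). h F \<in> var_ideal W U'}"
    unfolding var_ideal_def[of V U] using assms(2,4)
    by (intro ring.genideal_minimal[OF poly_ring_ring]) (auto intro: Var_in_poly_ring)
  then show ?thesis
    using assms(5) by blast
qed

lemma var_ideal_mono:
  assumes "X \<subseteq> V" and "U \<subseteq> X" and "U \<subseteq> U'" and "U' \<subseteq> V"
  shows "var_ideal X U \<subseteq> var_ideal V U'"
proof
  fix F assume F: "F \<in> var_ideal X U"
  show "F \<in> var_ideal V U'"
    by (rule ring_hom_var_ideal[OF poly_ring_inclusion_ring_hom[OF assms(1)] assms(2,4) _ F])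
      (use assms(3,4) in \<open>auto intro: Var_in_var_ideal\<close>)
qed

text \<open>If \<open>y\<close> is among the generators, it must go to 0: a nonzero constant
  \<open>c\<close> would be a unit.\<close>

lemma subst_const_var_ideal:
  assumes "F \<in> var_ideal (insert y X) U" and "U \<subseteq> insert y X" and "y \<notin> X" and "y \<in> U \<Longrightarrow> c = 0"
  shows "subst_const y c F \<in> var_ideal X (U \<inter> X)"
proof (rule ring_hom_var_ideal[OF subst_const_ring_hom assms(2) _ _ assms(1)])
  fix v assume v: "v \<in> U"
  show "subst_const y c (Var v) \<in> var_ideal X (U \<inter> X)"
  proof (cases "v = y")
    case True
    have "0 \<in> var_ideal X (U \<inter> X)"
      using additive_subgroup.zero_closed[OF ideal.axioms(1)[OF var_ideal_ideal[of "U \<inter> X" X]]]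
      by simp
    then show ?thesis
      using True v assms(4) by simp
  next
    case False
    then show ?thesis
      using v assms(2) by (auto simp: subst_const_Var_other intro: Var_in_var_ideal)
  qed
qed simp

text \<open>Everything is checked edge by edge: \<open>y\<close> lies in the prime of each edge
  through \<open>y\<close>, while the edges avoiding \<open>y\<close> are exactly those of the
  induced subhypergraph.\<close>

lemma cover_ideal_cone:
  assumes V: "verts H = insert y X" and y: "y \<notin> X"
    and edges: "\<And>e. e \<in> edges H \<Longrightarrow> e \<subseteq> insert y X"
    and V': "verts H' = X" and edges': "edges H' = (\<lambda>e. e \<inter> X) ` edges H"
  shows "cone_ideal X y (cover_ideal H' :: ('v, 'k::field) mpoly set)
    (cover_ideal (induced_subhypergraph H X)) (cover_ideal H)"
proof (rule cone_ideal.intro)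
  show "y \<notin> X" by fact
  show "ideal (cover_ideal H' :: ('v, 'k) mpoly set) (poly_ring X)"
    using cover_ideal_ideal[of H'] by (auto simp: V' edges')
  show "ideal (cover_ideal (induced_subhypergraph H X) :: ('v, 'k) mpoly set) (poly_ring X)"
    using cover_ideal_ideal[of "induced_subhypergraph H X"] by (auto simp: induced_subhypergraph_def)
  show "ideal (cover_ideal H :: ('v, 'k) mpoly set) (poly_ring (insert y X))"
    using cover_ideal_ideal[of H] edges by (auto simp: V)
  have incl: "carrier (poly_ring X) \<subseteq> carrier (poly_ring (insert y X) :: ('v, 'k) mpoly ring)"
    by (rule poly_ring_mono) auto
  have "var_ideal X (e \<inter> X) \<subseteq> (var_ideal (insert y X) e :: ('v, 'k) mpoly set)"
    if "e \<in> edges H" for e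
    using edges[OF that] by (intro var_ideal_mono) auto
  then show "cover_ideal H' \<subseteq> (cover_ideal H :: ('v, 'k) mpoly set)"
    using incl unfolding cover_ideal_def V V' edges' by blast
  show "a * Var y \<in> cover_ideal H" if a: "a \<in> cover_ideal (induced_subhypergraph H X)"
    for a :: "('v, 'k) mpoly"
  proof -
    interpret S: cring "poly_ring (insert y X) :: ('v, 'k) mpoly ring"
      by (rule poly_ring_cring)
    have aS: "a \<in> carrier (poly_ring (insert y X))"
      using a incl by (auto simp: cover_ideal_def induced_subhypergraph_def)
    have yS: "Var y \<in> carrier (poly_ring (insert y X))"
      by (simp add: Var_in_poly_ring)
    have "a * Var y \<in> var_ideal (insert y X) e" if e: "e \<in> edges H" for e
    proof -
      interpret I: ideal "var_ideal (insert y X) e" "poly_ring (insert y X) :: ('v, 'k) mpoly ring"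
        by (rule var_ideal_ideal[OF edges[OF e]])
      show ?thesis
      proof (cases "y \<in> e")
        case True
        then show ?thesis
          using I.I_l_closed[OF Var_in_var_ideal aS] edges[OF e] by simp
      next
        case False
        then have "e \<subseteq> X"
          using edges[OF e] by auto
        then have "a \<in> var_ideal X e"
          using a e by (auto simp: cover_ideal_def induced_subhypergraph_def)
        then have "a \<in> var_ideal (insert y X) e"
          using var_ideal_mono[of X "insert y X" e e] \<open>e \<subseteq> X\<close> by auto
        then show ?thesis
          using I.I_r_closed[OF _ yS] by simp
      qed
    qed
    then show ?thesis
      using S.m_closed[OF aS yS] by (simp add: cover_ideal_def V)
  qed
  show "subst_const y 0 F \<in> cover_ideal H'" if "F \<in> cover_ideal H" for F :: "('v, 'k) mpoly"
    using that subst_const_carrier[of F y X 0] subst_const_var_ideal[OF _ edges y, of F _ 0]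
    by (auto simp: cover_ideal_def V V' edges')
  show "subst_const y 1 F \<in> cover_ideal (induced_subhypergraph H X)" if F: "F \<in> cover_ideal H"
    for F :: "('v, 'k) mpoly"
  proof -
    \<comment> \<open>Such an edge does not contain \<open>y\<close>, so the value 1 is
      admissible.\<close>
    have "subst_const y 1 F \<in> var_ideal X e" if "e \<in> edges H" "e \<subseteq> X" for e
      using subst_const_var_ideal[of F y X e 1] F y that
      by (auto simp: cover_ideal_def V Int_absorb2)
    then show ?thesis
      using F subst_const_carrier[of F y X 1]
      by (auto simp: cover_ideal_def V induced_subhypergraph_def)
  qed
qed

theorem theorem4p1:
  fixes H H' :: "'v hypergraph" and X :: "'v set" and y :: 'v
    and p' :: "('v, 'k::field) mpoly set" and s :: nat
  assumes "simple_hypergraph H"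
    and "verts H = X \<union> {y}" and "y \<notin> X"
    and "\<exists>!e. e \<in> edges H \<and> y \<in> e"
    and "is_shadow H X H'"
    and "\<not> persistence_property (poly_ring X :: ('v, 'k) mpoly ring) (cover_ideal H')"
    and "primeideal p' (poly_ring X)" and "s > 0"
    and "p' \<in> ass (poly_ring X) (ideal_power (poly_ring X) (cover_ideal H') s)"
    and "p' \<notin> ass (poly_ring X) (ideal_power (poly_ring X) (cover_ideal H') (s + 1))"
    and "p' \<notin> ass (poly_ring X)
           (ideal_power (poly_ring X) (cover_ideal (induced_subhypergraph H X)) s)"
    and "Idl\<^bsub>poly_ring (verts H)\<^esub> p' <+>\<^bsub>poly_ring (verts H)\<^esub> PIdl\<^bsub>poly_ring (verts H)\<^esub> (Var y)
           \<notin> ass (poly_ring (verts H))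
               (colon (poly_ring (verts H))
                  (ideal_power (poly_ring (verts H)) (cover_ideal H) (s + 1)) (Var y))"
  shows "\<not> persistence_property (poly_ring (verts H) :: ('v, 'k) mpoly ring) (cover_ideal H)"
proof -
  have V: "verts H = insert y X"
    using assms(2) by simp
  interpret cone_ideal X y "cover_ideal H' :: ('v, 'k) mpoly set"
    "cover_ideal (induced_subhypergraph H X)" "cover_ideal H"
    using assms(1,3,5) V
    by (intro cover_ideal_cone) (auto simp: simple_hypergraph_def is_shadow_def)
  have "adjoin_var (insert y X) y p' \<in> ass S (ideal_power S (cover_ideal H) s)"
    using assms(7,9,11) by (rule adjoin_var_in_ass)
  moreover have "adjoin_var (insert y X) y p' \<notin> ass S (ideal_power S (cover_ideal H) (s + 1))"
    using assms(7,10) assms(12)[unfolded V] by (rule adjoin_var_not_in_ass)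
  ultimately have "\<not> ass S (ideal_power S (cover_ideal H) s)
      \<subseteq> ass S (ideal_power S (cover_ideal H) (s + 1))"
    by blast
  then show ?thesis
    using assms(8) unfolding persistence_property_def V by blast
qed

end
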